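(* Let $p_1,p_2$ be different prime numbers, and let $n_1,n_2,n_3$ be positive integers such that $n_1p_1$ is coprime with $n_2p_2$ and $n_1n_3$ is coprime with $n_2p_2$. Put $N=n_1n_2n_3p_1p_2$. Let $H$ be the subgroup $H=p_1\mathbb{I}_{n_1n_2n_3p_2}$ of $\mathbb{Z}_N$, and let $K$ be a complete set of coset representatives for $\mathbb{Z}_N$ modulo $H$, written as a disjoint union $K=K_1\cup K_2$. Define subsets of $\mathbb{Z}_N$ by $$A=n_1p_1n_3\mathbb{I}_{n_2},\qquad B=n_2p_2p_1\mathbb{I}_{n_1},$$ $$U=n_1n_2n_3p_1\mathbb{I}_{p_2},\qquad V=n_1p_1n_2p_2\mathbb{I}_{n_3},$$ $$U'=n_2p_1\mathbb{I}_{p_2},\qquad V'=n_1p_1\mathbb{I}_{n_3}.$$ Let $$S=A+B,\qquad R=(U+V'+K_1)\cup(U'+V+K_2).$$ If $R$ is a non-periodic subset of $\mathbb{Z}_N$, then $(S,R)$ is a Vuza canon of $\mathbb{Z}_N$.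
   Context: $\mathbb{Z}_N=\{0,1,\dots,N-1\}$ denotes the cyclic group of order $N$ (addition modulo $N$). For positive integers $k,a$, $k\mathbb{I}_a=\{0,\ k\bmod N,\ 2k\bmod N,\dots,(a-1)k\bmod N\}\subseteq\mathbb{Z}_N$. Sums of subsets are $X+Y=\{x+y:x\in X,y\in Y\}$. For non-empty subsets $S,R$ of a finite cyclic group $G$, $G=S\oplus R$ means that every $g\in G$ can be written uniquely as $g=s+r$ with $s\in S$, $r\in R$. A non-empty subset $T$ of $G$ is periodic if there is $g\in G$, $g\neq0$, with $T+g=T$; otherwise it is non-periodic. A Vuza canon of $G$ is a pair $(S,R)$ of non-empty subsets of $G$ such that $G=S\oplus R$ and neither $S$ nor $R$ is periodic.
   Formalization: The formal theorem adds the assumption that n_1=1 whenever n_3=1; if n_3=1 and n_1>1, B is a whole nontrivial subgroup, so S is periodic and the claim fails (e.g. p_1=2, p_2=3, n_1=2, n_2=n_3=1, K_1={0}, K_2={1}). *)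

theory Defs
  imports "HOL-Algebra.Elementary_Groups" "HOL-Computational_Algebra.Primes"
begin

text \<open>
  The cyclic group of order \<open>N > 0\<close> is \<^const>\<open>integer_mod_group\<close> \<open>N\<close>, with carrier
  \<open>{0..<int N}\<close> and addition modulo \<open>N\<close>. It is written multiplicatively: the sum of two subsets
  is \<open>X <#>\<^bsub>G\<^esub> Y\<close>, and the translate \<open>T + g\<close> is \<open>T #>\<^bsub>G\<^esub> g\<close>.
\<close>

definition multiples :: "nat \<Rightarrow> nat \<Rightarrow> nat \<Rightarrow> int set" where
  "multiples N k a = {int ((i * k) mod N) | i. i < a}"

definition factorization :: "('a, 'b) monoid_scheme \<Rightarrow> 'a set \<Rightarrow> 'a set \<Rightarrow> bool" where
  "factorization G S R \<longleftrightarrow>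
     S \<noteq> {} \<and> R \<noteq> {} \<and> S \<subseteq> carrier G \<and> R \<subseteq> carrier G \<and>
     (\<forall>g \<in> carrier G. \<exists>!p. p \<in> S \<times> R \<and> g = fst p \<otimes>\<^bsub>G\<^esub> snd p)"

definition periodic :: "('a, 'b) monoid_scheme \<Rightarrow> 'a set \<Rightarrow> bool" where
  "periodic G T \<longleftrightarrow> (\<exists>g \<in> carrier G. g \<noteq> \<one>\<^bsub>G\<^esub> \<and> T #>\<^bsub>G\<^esub> g = T)"

definition vuza_canon :: "('a, 'b) monoid_scheme \<Rightarrow> 'a set \<Rightarrow> 'a set \<Rightarrow> bool" where
  "vuza_canon G S R \<longleftrightarrow> factorization G S R \<and> \<not> periodic G S \<and> \<not> periodic G R"

definition coset_representatives :: "('a, 'b) monoid_scheme \<Rightarrow> 'a set \<Rightarrow> 'a set \<Rightarrow> bool" where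
  "coset_representatives G H K \<longleftrightarrow>
     K \<subseteq> carrier G \<and> (\<forall>C \<in> rcosets\<^bsub>G\<^esub> H. \<exists>!k. k \<in> K \<and> k \<in> C)"

end

theory Submission
  imports Defs "HOL-Number_Theory.Cong"
begin

text \<open>
  Everything except \<open>K\<close> lies in the subgroup \<open>H = p1 \<int>\<close> of \<open>\<int>\<^sub>N\<close>, which is cyclic of order
  \<open>m = n1 n2 n3 p2\<close>. Dividing by \<open>p1\<close>, the set \<open>S\<close> becomes \<open>{n1 n3 i + n2 p2 j | i < n2, j < n1}\<close>
  modulo \<open>m\<close>, and the two complements \<open>U + V'\<close> and \<open>U' + V\<close> become
  \<open>{n1 n3 n2 x + n1 y | x < p2, y < n3}\<close> and \<open>{n2 p2 n1 y + n2 x | x < p2, y < n3}\<close>. Since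
  \<open>n1 n3\<close> and \<open>n2 p2\<close> are coprime, \<open>\<int>\<^sub>m\<close> splits into \<open>\<int>\<close> modulo \<open>n1 n3\<close> and \<open>\<int>\<close> modulo \<open>n2 p2\<close>,
  and the pairs \<open>(n1, n3)\<close> and \<open>(n2, p2)\<close> play symmetric roles.

  \<^emph>\<open>Factorization.\<close> Both complements tile \<open>H\<close> together with \<open>S\<close>: the representation of an element of
  \<open>\<int>\<^sub>m\<close> in the first of the two systems is found digit by digit, \<open>j\<close> from its residue modulo \<open>n1\<close>,
  then \<open>y\<close> from its residue modulo \<open>n1 n3\<close>, then \<open>i\<close> and \<open>x\<close> as the two digits of \<open>i + n2 x\<close>, which is
  determined modulo \<open>n2 p2\<close> (\<open>mixed_radix_exists\<close>, \<open>mixed_radix_unique\<close>). The second system is the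
  first one with the two pairs exchanged. A translate of a complement of \<open>S\<close> in \<open>H\<close> tiles a coset of
  \<open>H\<close>, so one may choose either complement in each coset independently
  (\<open>factorization_coset_wise\<close>); \<open>R\<close> does so according to the partition of \<open>K\<close>.

  \<^emph>\<open>Aperiodicity of S.\<close> In the two coordinates of \<open>\<int>\<^sub>m\<close>, the set \<open>S\<close> is a product of intervals, of
  length \<open>n2\<close> in a cycle of length \<open>n2 p2\<close> and of length \<open>n1\<close> in a cycle of length \<open>n1 n3\<close>, up to
  units. An interval that is neither empty nor the whole cycle has no period
  (\<open>interval_shift_trivial\<close>), and neither has the whole cycle of length one, which is what remains of
  the second factor when \<open>n3 = 1\<close> forces \<open>n1 = 1\<close>.
\<close>

section \<open>Mixed radix systems modulo a product of coprime numbers\<close>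

lemma linear_cong_solution:
  fixes q m :: nat and h :: int
  assumes "coprime q m" "m > 0"
  obtains j where "j < m" "[int q * int j = h] (mod int m)"
proof -
  have "coprime (int q) (int m)"
    using assms by simp
  then obtain z where z: "[int q * z = 1] (mod int m)"
    using cong_solve_coprime_int by blast
  let ?j = "nat ((z * h) mod int m)"
  have j: "int ?j = (z * h) mod int m"
    using assms by simp
  have "[int q * int ?j = int q * (z * h)] (mod int m)"
    unfolding j by (simp add: cong_def mod_mult_right_eq)
  also have "[int q * (z * h) = 1 * h] (mod int m)"
    using cong_mult[OF z cong_refl, of h] by (simp add: mult.assoc)
  finally have "[int q * int ?j = h] (mod int m)" by simp
  moreover have "?j < m"
    using assms j by (metis of_nat_0_less_iff of_nat_less_iff pos_mod_bound)
  ultimately show thesis using that by blast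
qed

lemma linear_cong_unique:
  fixes q m i j :: nat
  assumes "coprime q m" "i < m" "j < m" "[int q * int i = int q * int j] (mod int m)"
  shows "i = j"
proof -
  have "coprime (int q) (int m)"
    using assms(1) by simp
  then have "[int i = int j] (mod int m)"
    using assms(4) by (rule cong_mult_lcancel[THEN iffD1])
  then show ?thesis
    using assms(2,3) by (simp add: cong_def)
qed

text \<open>
  The four digits are chosen triangularly: modulo \<open>a\<close> only the term of \<open>j\<close> survives, modulo \<open>a b\<close> only
  those of \<open>j\<close> and \<open>y\<close>, and modulo \<open>c d\<close> the terms of \<open>i\<close> and \<open>x\<close> combine to a unit times \<open>i + c x\<close>.
\<close>

lemma mixed_radix_exists:
  fixes a b c d :: nat and h :: int
  assumes cop: "coprime (a * b) (c * d)" and pos: "a > 0" "b > 0" "c > 0" "d > 0"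
  obtains i j x y where "i < c" "j < a" "x < d" "y < b"
    "[int (a*b*i + c*d*j + a*b*c*x + a*y) = h] (mod int (a*b*c*d))"
proof -
  have "coprime (c * d) a"
    using cop by (simp add: coprime_commute)
  then obtain j where j: "j < a" "[int (c * d) * int j = h] (mod int a)"
    using linear_cong_solution pos by blast
  then have "int a dvd h - int (c * d) * int j"
    by (meson cong_iff_dvd_diff cong_sym)
  then obtain t where t: "h - int (c * d) * int j = int a * t" ..
  \<comment> \<open>As \<open>a y\<close> only matters modulo \<open>a b\<close>, \<open>t\<close> may be replaced by its residue modulo \<open>b\<close>.\<close>
  define y where "y = nat (t mod int b)"
  have y: "y < b" "int y = t mod int b"
    using pos by (auto simp: y_def nat_less_iff)
  have "int b dvd int y - t"
    unfolding y(2) by (metis cong_iff_dvd_diff cong_mod_left cong_refl)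
  then have y_cong: "int (a * b) dvd int a * int y - int a * t"
    by (simp flip: right_diff_distrib)
  obtain w where w: "w < c * d"
    "[int (a * b) * int w = h - int (c * d) * int j - int a * int y] (mod int (c * d))"
    using linear_cong_solution[OF cop] pos by (metis nat_0_less_mult_iff)
  define i x where "i = w mod c" and "x = w div c"
  have ix: "w = i + c * x" "i < c" "x < d"
    using w(1) pos by (auto simp: i_def x_def less_mult_imp_div_less mult.commute)
  let ?e = "int (a*b*i + c*d*j + a*b*c*x + a*y)"
  have e: "?e = int (a * b) * int w + int (c * d) * int j + int a * int y"
    by (simp add: ix(1) algebra_simps)
  have "int (c * d) dvd ?e - h"
    using w(2) unfolding e cong_iff_dvd_diff by (simp add: algebra_simps)
  \<comment> \<open>Modulo \<open>a b\<close> the choice of \<open>w\<close> is invisible, so the choices of \<open>j\<close> and \<open>y\<close> are not disturbed.\<close>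
  moreover have "?e - h = int (a * b) * int w + (int a * int y - int a * t)"
    unfolding e using t by simp
  then have "int (a * b) dvd ?e - h"
    using y_cong by (metis dvd_add dvd_triv_left)
  ultimately have "int (a * b) * int (c * d) dvd ?e - h"
    using cop by (intro divides_mult) auto
  then have "[?e = h] (mod int (a*b*c*d))"
    by (simp add: cong_iff_dvd_diff mult.assoc)
  then show thesis using that ix(2,3) j(1) y(1) by blast
qed

text \<open>
  The digits are recovered in the same order in which they are chosen above: \<open>j\<close>, then \<open>y\<close>, then
  \<open>i + c x\<close>.
\<close>

lemma mixed_radix_unique:
  fixes a b c d :: nat
  assumes cop: "coprime (a * b) (c * d)" and pos: "a > 0"
    and less: "i < c" "j < a" "x < d" "y < b" "i' < c" "j' < a" "x' < d" "y' < b"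
    and eq: "[int (a*b*i + c*d*j + a*b*c*x + a*y)
            = int (a*b*i' + c*d*j' + a*b*c*x' + a*y')] (mod int (a*b*c*d))"
  shows "i = i' \<and> j = j' \<and> x = x' \<and> y = y'"
proof -
  let ?e = "\<lambda>i j x y. int (a*b*i + c*d*j + a*b*c*x + a*y)"
  have split: "?e i j x y = int (c*d) * int j + int a * int (b * (i + c * x) + y)"
       for i j x y by (simp add: algebra_simps)
  have split2: "?e i j x y = int (c*d) * int j + (int a * int y + int (a * b) * int (i + c * x))"
       for i j x y by (simp add: algebra_simps)
  have "[?e i j x y = ?e i' j' x' y'] (mod int a)"
    using eq by (rule cong_dvd_modulus) simp
  then have "[int (c*d) * int j = int (c*d) * int j'] (mod int a)"
    unfolding split by (simp add: cong_def)
  then have j: "j = j'"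
    using linear_cong_unique[of "c*d" a j j'] cop less by (simp add: coprime_commute)
  have "[?e i j x y = ?e i' j' x' y'] (mod int (a*b))"
    using eq by (rule cong_dvd_modulus) simp
  then have "[int a * int y = int a * int y'] (mod int (a*b))"
    unfolding split2 j cong_add_lcancel by (simp only: cong_def mod_mult_self2)
  then have "[int y = int y'] (mod int b)"
    using pos by (simp add: cong_def mult_mod_right[symmetric])
  then have y: "y = y'"
    using less(4,8) by (simp add: cong_def)
  have "[?e i j x y = ?e i' j' x' y'] (mod int (c*d))"
    using eq by (rule cong_dvd_modulus) simp
  then have "[int (a*b) * int (i + c * x) = int (a*b) * int (i' + c * x')] (mod int (c*d))"
    unfolding split2 j y cong_add_lcancel .
  moreover have bound: "i + c * x < c * d" if "i < c" "x < d" for i x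
  proof -
    have "i + c * x < c * Suc x" using that by simp
    also have "\<dots> \<le> c * d" using that by (intro mult_le_mono2) simp
    finally show ?thesis .
  qed
  ultimately have "i + c * x = i' + c * x'"
    using linear_cong_unique[OF cop bound bound] less by blast
  moreover from this have "i = i'"
    using less by (metis mod_less mod_mult_self2)
  ultimately show ?thesis
    using j y less by auto
qed

text \<open>
  If a proper interval \<open>{0..<c}\<close> of the cycle of length \<open>c d\<close> were mapped into itself by a shift by
  \<open>e > 0\<close>, then \<open>c - e\<close> would be sent to \<open>c\<close>, just outside the interval. When \<open>d = 1\<close>, the bound
  \<open>e < c = 1\<close> alone gives \<open>e = 0\<close>. The factor \<open>q\<close> is a unit; it
  appears in the statement because the intervals in question occur only up to such a factor.
\<close>

lemma interval_shift_trivial: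
  fixes q c d e :: nat
  assumes "coprime q (c * d)" "d = 1 \<longrightarrow> c = 1" "d > 0" "e < c"
    and closed: "\<And>i. i < c \<Longrightarrow> \<exists>i'<c. [int q * int (i + e) = int q * int i'] (mod int (c * d))"
  shows "e = 0"
proof (rule ccontr)
  assume "e \<noteq> 0"
  with assms have "c * 1 < c * d" by (intro mult_strict_left_mono) auto
  obtain i' where "i' < c" "[int q * int c = int q * int i'] (mod int (c * d))"
    using closed[of "c - e"] \<open>e \<noteq> 0\<close> \<open>e < c\<close> by auto
  with linear_cong_unique[OF assms(1), of c i'] \<open>c * 1 < c * d\<close> show False
    by simp
qed

section \<open>Subsets of a finite cyclic group\<close>

lemma mem_multiples_iff:
  assumes "N > 0"
  shows "g \<in> multiples N k a \<longleftrightarrow> g \<in> {0..<int N} \<and> (\<exists>i<a. [g = int (i * k)] (mod int N))"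
  using assms by (auto simp: multiples_def cong_def zmod_int)

lemma mem_set_mult_iff:
  assumes "N > 0" "g \<in> {0..<int N}"
  shows "g \<in> X <#>\<^bsub>integer_mod_group N\<^esub> Y \<longleftrightarrow> (\<exists>x\<in>X. \<exists>y\<in>Y. [g = x + y] (mod int N))"
  using assms by (auto simp: set_mult_def cong_def)

lemma set_mult_subset_carrier:
  assumes "N > 0"
  shows "X <#>\<^bsub>integer_mod_group N\<^esub> Y \<subseteq> {0..<int N}"
  using assms by (auto simp: set_mult_def)

lemma multiples_set_mult:
  assumes "N > 0"
  shows "g \<in> multiples N k a <#>\<^bsub>integer_mod_group N\<^esub> multiples N l b \<longleftrightarrow>
    g \<in> {0..<int N} \<and> (\<exists>i<a. \<exists>j<b. [g = int (i * k + j * l)] (mod int N))"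
    (is "?l \<longleftrightarrow> ?r")
proof
  assume ?l
  then have g: "g \<in> {0..<int N}" using set_mult_subset_carrier[OF assms] by blast
  with \<open>?l\<close> obtain x y where "x \<in> multiples N k a" "y \<in> multiples N l b" "[g = x + y] (mod int N)"
    using mem_set_mult_iff[OF assms] by blast
  moreover then obtain i j where "i < a" "[x = int (i * k)] (mod int N)"
    "j < b" "[y = int (j * l)] (mod int N)"
    unfolding mem_multiples_iff[OF assms] by blast
  ultimately have "[g = int (i * k + j * l)] (mod int N)"
    unfolding of_nat_add by (blast intro: cong_add cong_trans)
  with g \<open>i < a\<close> \<open>j < b\<close> show ?r by blast
next
  assume ?r
  then obtain i j where ij: "i < a" "j < b" "[g = int (i * k + j * l)] (mod int N)" and g: "g \<in> {0..<int N}"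
    by blast
  have "int ((i * k) mod N) \<in> multiples N k a" "int ((j * l) mod N) \<in> multiples N l b"
    using ij unfolding multiples_def by blast+
  moreover have "[g = int ((i * k) mod N) + int ((j * l) mod N)] (mod int N)"
    using ij(3) by (simp add: cong_def zmod_int mod_add_eq)
  ultimately show ?l
    using mem_set_mult_iff[OF assms g] by blast
qed

lemma multiples_set_mult_set:
  assumes "N > 0"
  shows "g \<in> multiples N k a <#>\<^bsub>integer_mod_group N\<^esub> multiples N l b <#>\<^bsub>integer_mod_group N\<^esub> X \<longleftrightarrow>
    g \<in> {0..<int N} \<and> (\<exists>i<a. \<exists>j<b. \<exists>x\<in>X. [g = int (i * k + j * l) + x] (mod int N))"
    (is "?l \<longleftrightarrow> ?r")
proof
  assume ?l
  then have g: "g \<in> {0..<int N}" using set_mult_subset_carrier[OF assms] by blast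
  with \<open>?l\<close> obtain z x where
    "z \<in> multiples N k a <#>\<^bsub>integer_mod_group N\<^esub> multiples N l b" "x \<in> X" "[g = z + x] (mod int N)"
    using mem_set_mult_iff[OF assms] by blast
  moreover then obtain i j where "i < a" "j < b" "[z = int (i * k + j * l)] (mod int N)"
    unfolding multiples_set_mult[OF assms] by blast
  ultimately have "[g = int (i * k + j * l) + x] (mod int N)"
    by (blast intro: cong_add cong_trans cong_refl)
  with g \<open>i < a\<close> \<open>j < b\<close> \<open>x \<in> X\<close> show ?r by blast
next
  assume ?r
  then obtain i j x where ij: "i < a" "j < b" "x \<in> X" "[g = int (i * k + j * l) + x] (mod int N)"
    and g: "g \<in> {0..<int N}"
    by blast
  let ?z = "int (i * k + j * l) mod int N"
  have "[?z = int (i * k + j * l)] (mod int N)" by (simp add: cong_def)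
  then have "?z \<in> multiples N k a <#>\<^bsub>integer_mod_group N\<^esub> multiples N l b"
    unfolding multiples_set_mult[OF assms] using ij(1,2) assms
    by (metis atLeastLessThan_iff of_nat_0_less_iff pos_mod_bound pos_mod_sign)
  moreover have "[g = ?z + x] (mod int N)"
    using ij(4) by (simp add: cong_def mod_add_left_eq)
  ultimately show ?l
    unfolding mem_set_mult_iff[OF assms g] using ij(3) by blast
qed

text \<open>
  For \<open>p\<close> dividing \<open>N\<close>, cosets of the subgroup generated by \<open>p\<close> are residue classes modulo \<open>p\<close>. This turns
  coset representatives into a complete residue system.
\<close>

lemma r_coset_multiples:
  assumes "N = p * m" "N > 0"
  shows "multiples N p m #>\<^bsub>integer_mod_group N\<^esub> g = {x \<in> {0..<int N}. [x = g] (mod int p)}"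
proof (intro equalityI subsetI)
  fix x assume "x \<in> multiples N p m #>\<^bsub>integer_mod_group N\<^esub> g"
  then obtain i where x: "x = (int ((i * p) mod N) + g) mod int N"
    by (auto simp: r_coset_def multiples_def)
  then have "[x = int (i * p) + g] (mod int N)"
    by (simp add: cong_def zmod_int mod_add_left_eq)
  then have "[x = int (i * p) + g] (mod int p)"
    by (rule cong_dvd_modulus) (simp add: assms)
  then show "x \<in> {x \<in> {0..<int N}. [x = g] (mod int p)}"
    using assms(2) x by (simp add: cong_def)
next
  fix x assume "x \<in> {x \<in> {0..<int N}. [x = g] (mod int p)}"
  then have x: "x \<in> {0..<int N}" "[x = g] (mod int p)" by auto
  then obtain t where t: "x - g = int p * t"
    by (meson cong_iff_dvd_diff dvdE)
  let ?i = "nat (t mod int m)"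
  have m: "m > 0" using assms by (cases m) auto
  have i: "?i < m" "int ?i = t mod int m"
    using m by (auto simp: nat_less_iff)
  have "int (?i * p) = int p * (t mod int m)"
    unfolding of_nat_mult i(2) by (rule mult.commute)
  also have "\<dots> = (int p * t) mod int N"
    by (simp add: assms(1))
  finally have "(int ((?i * p) mod N) + g) mod int N = (int p * t + g) mod int N"
    by (simp add: zmod_int mod_add_left_eq)
  also have "\<dots> = x"
    using x(1) unfolding t[symmetric] by simp
  finally show "x \<in> multiples N p m #>\<^bsub>integer_mod_group N\<^esub> g"
    using i(1) by (force simp: r_coset_def multiples_def)
qed

lemma coset_representatives_ex1:
  assumes "N = p * m" "N > 0"
    and "coset_representatives (integer_mod_group N) (multiples N p m) K"
  shows "\<exists>!k. k \<in> K \<and> [k = g] (mod int p)"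
proof -
  let ?G = "integer_mod_group N"
  have K: "K \<subseteq> {0..<int N}"
    using assms(2,3) by (auto simp: coset_representatives_def carrier_integer_mod_group)
  have g: "g mod int N \<in> carrier ?G"
    using assms(2) by (simp add: carrier_integer_mod_group)
  let ?C = "multiples N p m #>\<^bsub>?G\<^esub> (g mod int N)"
  have "?C \<in> rcosets\<^bsub>?G\<^esub> (multiples N p m)"
    using g by (auto simp: RCOSETS_def)
  then have "\<exists>!k. k \<in> K \<and> k \<in> ?C"
    using assms(3) by (auto simp: coset_representatives_def)
  moreover have "k \<in> ?C \<longleftrightarrow> [k = g] (mod int p)" if "k \<in> K" for k
    using that K unfolding r_coset_multiples[OF assms(1,2)]
    by (auto simp: cong_def assms(1) mod_mod_cancel)
  ultimately show ?thesis by (metis (no_types, lifting))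
qed

section \<open>Factorizations with a different complement in each coset\<close>

text \<open>
  Modulo \<open>p\<close> an element \<open>s + r\<close> only sees the representative \<open>k\<close> used in \<open>r\<close>, because \<open>S\<close> lies in the
  subgroup generated by \<open>p\<close>. Hence \<open>k\<close> is determined first, and what remains is the tiling of
  \<open>\<int>\<^sub>m\<close> belonging to that \<open>k\<close>. The complement \<open>r k\<close> may therefore vary with \<open>k\<close>. Index sets \<open>I\<close> and
  \<open>J\<close> stand for the digits, so that the tiling is a statement about integers.
\<close>

lemma factorization_coset_wise:
  fixes s :: "'i \<Rightarrow> int" and r :: "int \<Rightarrow> 'j \<Rightarrow> int"
  assumes N: "N = p * m" "N > 0"
    and reps: "coset_representatives (integer_mod_group N) (multiples N p m) K"
    and tiling: "\<And>k h. \<exists>!q. q \<in> I \<times> J \<and> [s (fst q) + r k (snd q) = h] (mod int m)"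
    and S: "\<And>g. g \<in> S \<longleftrightarrow> g \<in> {0..<int N} \<and> (\<exists>i\<in>I. [g = int p * s i] (mod int N))"
    and R: "\<And>g. g \<in> R \<longleftrightarrow>
      g \<in> {0..<int N} \<and> (\<exists>k\<in>K. \<exists>j\<in>J. [g = k + int p * r k j] (mod int N))"
  shows "factorization (integer_mod_group N) S R"
proof -
  have carrier: "carrier (integer_mod_group N) = {0..<int N}"
    using N by (simp add: carrier_integer_mod_group)
  have p: "p > 0" using N by (cases p) auto
  have unique_pair: "\<exists>!q. q \<in> S \<times> R \<and> g = (fst q + snd q) mod int N" if g: "g \<in> {0..<int N}" for g
  proof -
    obtain k where k: "k \<in> K" "[k = g] (mod int p)"
      using coset_representatives_ex1[OF N reps, of g] by blast
    then obtain t where t: "g - k = int p * t"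
      by (meson cong_iff_dvd_diff cong_sym dvdE)
    obtain i j where ij: "i \<in> I" "j \<in> J" "[s i + r k j = t] (mod int m)"
      using tiling[of k t] by (auto simp: mem_Times_iff)
    let ?s = "(int p * s i) mod int N" and ?r = "(k + int p * r k j) mod int N"
    have in_SR: "?s \<in> S" "?r \<in> R"
      unfolding S R using ij(1,2) k(1) N(2) by (auto simp: cong_def)
    have "[int p * (s i + r k j) = int p * t] (mod int N)"
      unfolding N(1) of_nat_mult using ij(3) by (rule cong_cmult_leftI)
    then have "[k + int p * (s i + r k j) = k + int p * t] (mod int N)"
      by (rule cong_add[OF cong_refl])
    then have "(?s + ?r) mod int N = g mod int N"
      unfolding t[symmetric] by (simp add: cong_def mod_add_eq algebra_simps)
    then have g_eq: "g = (?s + ?r) mod int N"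
      using g by simp
    have unique: "s' = ?s \<and> r' = ?r"
      if s': "s' \<in> S" and r': "r' \<in> R" and eq: "g = (s' + r') mod int N" for s' r'
    proof -
      obtain i' where i': "i' \<in> I" "[s' = int p * s i'] (mod int N)"
        using s' unfolding S by blast
      obtain k' j' where kj': "k' \<in> K" "j' \<in> J" "[r' = k' + int p * r k' j'] (mod int N)"
        using r' unfolding R by blast
      have "[g = s' + r'] (mod int N)"
        unfolding eq by (simp add: cong_def)
      also have "[s' + r' = int p * s i' + (k' + int p * r k' j')] (mod int N)"
        using i'(2) kj'(3) by (rule cong_add)
      finally have g': "[g = k' + int p * (s i' + r k' j')] (mod int N)"
        by (simp add: algebra_simps)
      then have "[g = k' + int p * (s i' + r k' j')] (mod int p)"
        by (rule cong_dvd_modulus) (simp add: N)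
      then have "[k' = g] (mod int p)"
        by (simp add: cong_def)
      then have "k' = k"
        using coset_representatives_ex1[OF N reps, of g] k kj'(1) by blast
      have "g - (k + int p * (s i' + r k j')) = int p * (t - (s i' + r k j'))"
        using t by (simp add: algebra_simps)
      then have "int p * int m dvd int p * (t - (s i' + r k j'))"
        using g' unfolding \<open>k' = k\<close> cong_iff_dvd_diff N(1) by simp
      then have "[t = s i' + r k j'] (mod int m)"
        using p by (simp add: cong_iff_dvd_diff)
      then have "[s i' + r k j' = t] (mod int m)"
        by (rule cong_sym)
      with tiling[of k t] ij i'(1) kj'(2) have "(i', j') = (i, j)"
        by (metis fst_conv snd_conv mem_Sigma_iff)
      moreover have "s' = s' mod int N" "r' = r' mod int N"
        using s' r' unfolding S R by auto
      ultimately show ?thesis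
        using i'(2) kj'(3) \<open>k' = k\<close> unfolding cong_def by auto
    qed
    show ?thesis
    proof (rule ex1I[of _ "(?s, ?r)"])
      show "(?s, ?r) \<in> S \<times> R \<and> g = (fst (?s, ?r) + snd (?s, ?r)) mod int N"
        unfolding fst_conv snd_conv using in_SR g_eq by blast
    next
      fix q assume q: "q \<in> S \<times> R \<and> g = (fst q + snd q) mod int N"
      then have "fst q = ?s \<and> snd q = ?r"
        by (intro unique) (simp_all only: mem_Times_iff)
      then show "q = (?s, ?r)"
        by (simp only: prod_eq_iff fst_conv snd_conv)
    qed
  qed
  have "S \<subseteq> {0..<int N}" "R \<subseteq> {0..<int N}"
    by (auto simp: S R)
  moreover have "S \<noteq> {}" "R \<noteq> {}"
    using unique_pair[of 0] N(2) by auto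
  ultimately show ?thesis
    using unique_pair by (simp add: factorization_def carrier)
qed

section \<open>Sums of intervals without periods\<close>

text \<open>
  Since \<open>0 \<in> S\<close>, a period \<open>g\<close> of \<open>S\<close> lies in \<open>S\<close> and has digits \<open>e\<close> and \<open>f\<close>. Reduction modulo \<open>c d\<close>
  and modulo \<open>a b\<close> separates the two coordinates and makes \<open>e\<close> and \<open>f\<close> shifts that preserve an
  interval, so both vanish.
\<close>

lemma not_periodic_sum_of_intervals:
  fixes a b c d p N :: nat
  assumes cop: "coprime (a * b) (c * d)" and pos: "a > 0" "b > 0" "c > 0" "d > 0"
    and nontriv: "b = 1 \<longrightarrow> a = 1" "d = 1 \<longrightarrow> c = 1"
    and N: "N = p * (a * b * c * d)" "N > 0"
    and S: "\<And>g. g \<in> S \<longleftrightarrow> g \<in> {0..<int N} \<and>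
      (\<exists>i<c. \<exists>j<a. [g = int p * int (a*b*i + c*d*j)] (mod int N))"
  shows "\<not> periodic (integer_mod_group N) S"
proof
  assume "periodic (integer_mod_group N) S"
  then obtain g where g: "g \<in> {0..<int N}" "g \<noteq> 0" "S #>\<^bsub>integer_mod_group N\<^esub> g = S"
    using N by (auto simp: periodic_def carrier_integer_mod_group)
  have p: "p > 0" using N by (cases p) auto
  have translate: "(x + g) mod int N \<in> S" if "x \<in> S" for x
    using that g(3) by (auto simp: r_coset_def)
  have "0 \<in> S"
    unfolding S using pos N by (auto intro!: exI[of _ 0])
  from translate[OF this] have "g \<in> S"
    using g(1) by simp
  then obtain e f where ef: "e < c" "f < a" "[g = int p * int (a*b*e + c*d*f)] (mod int N)"
    unfolding S by blast
  have shift: "\<exists>i'<c. \<exists>j'<a.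
      [int (a*b*(i+e) + c*d*(j+f)) = int (a*b*i' + c*d*j')] (mod int (a*b) * int (c*d))"
    if ij: "i < c" "j < a" for i j
  proof -
    let ?x = "(int p * int (a*b*i + c*d*j)) mod int N"
    have x: "[?x = int p * int (a*b*i + c*d*j)] (mod int N)"
      by (simp add: cong_def)
    moreover have "?x \<in> {0..<int N}"
      using N(2) by simp
    ultimately have "?x \<in> S"
      unfolding S using ij by blast
    from translate[OF this] obtain i' j' where ij': "i' < c" "j' < a"
      "[(?x + g) mod int N = int p * int (a*b*i' + c*d*j')] (mod int N)"
      unfolding S by blast
    have "[int p * int (a*b*i + c*d*j) + int p * int (a*b*e + c*d*f) = ?x + g] (mod int N)"
      using cong_sym[OF cong_add[OF x ef(3)]] .
    also have "[?x + g = int p * int (a*b*i' + c*d*j')] (mod int N)"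
      using ij'(3) unfolding cong_def by simp
    finally have "[int p * int (a*b*(i+e) + c*d*(j+f)) = int p * int (a*b*i' + c*d*j')] (mod int N)"
      by (simp add: algebra_simps)
    then have "int p * (int (a*b) * int (c*d)) dvd
        int p * (int (a*b*(i+e) + c*d*(j+f)) - int (a*b*i' + c*d*j'))"
      unfolding cong_iff_dvd_diff N(1) right_diff_distrib by (simp only: of_nat_mult mult.assoc)
    then have "[int (a*b*(i+e) + c*d*(j+f)) = int (a*b*i' + c*d*j')] (mod int (a*b) * int (c*d))"
      unfolding cong_iff_dvd_diff using p by (simp only: dvd_mult_cancel_left) simp
    with ij' show ?thesis by blast
  qed
  have "e = 0"
  proof (rule interval_shift_trivial[OF cop nontriv(2) pos(4) ef(1)])
    fix i assume "i < c"
    then obtain i' j' where "i' < c"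
      "[int (a*b*(i+e) + c*d*(0+f)) = int (a*b*i' + c*d*j')] (mod int (a*b) * int (c*d))"
      using shift pos by blast
    then have "[int (a*b*(i+e) + c*d*(0+f)) = int (a*b*i' + c*d*j')] (mod int (c*d))"
      by (auto intro: cong_dvd_modulus)
    then have "[int (a*b) * int (i+e) = int (a*b) * int i'] (mod int (c*d))"
      by (simp only: of_nat_add[of "a*b*_"] of_nat_mult[of "c*d"] of_nat_mult[of "a*b"]
            cong_def mod_mult_self2)
    with \<open>i' < c\<close> show "\<exists>i'<c. [int (a*b) * int (i+e) = int (a*b) * int i'] (mod int (c*d))"
      by blast
  qed
  moreover have "f = 0"
  proof (rule interval_shift_trivial[of "c*d" a b])
    fix j assume "j < a"
    then obtain i' j' where "j' < a"
      "[int (a*b*(0+e) + c*d*(j+f)) = int (a*b*i' + c*d*j')] (mod int (a*b) * int (c*d))"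
      using shift pos by blast
    then have "[int (a*b*(0+e) + c*d*(j+f)) = int (a*b*i' + c*d*j')] (mod int (a*b))"
      by (auto intro: cong_dvd_modulus)
    then have "[int (c*d) * int (j+f) = int (c*d) * int j'] (mod int (a*b))"
      by (simp only: of_nat_add[of "a*b*_"] of_nat_mult[of "c*d"] of_nat_mult[of "a*b"]
            cong_def mod_mult_self4)
    with \<open>j' < a\<close> show "\<exists>j'<a. [int (c*d) * int (j+f) = int (c*d) * int j'] (mod int (a*b))"
      by blast
  qed (use cop nontriv pos ef in \<open>simp_all add: coprime_commute\<close>)
  ultimately have "[g = 0] (mod int N)"
    using ef(3) by simp
  with g(1,2) show False
    by (simp add: cong_def)
qed

section \<open>The canon\<close>

theorem theorem15:
  fixes p1 p2 n1 n2 n3 N :: nat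
    and G :: "int monoid"
    and H K K1 K2 A B U V U' V' S R :: "int set"
  assumes "prime p1" and "prime p2" and "p1 \<noteq> p2"
    and "n1 > 0" and "n2 > 0" and "n3 > 0"
    and "coprime (n1 * p1) (n2 * p2)"
    and "coprime (n1 * n3) (n2 * p2)"
    and nondegenerate: "n3 = 1 \<longrightarrow> n1 = 1"
    and "N = n1 * n2 * n3 * p1 * p2"
    and "G = integer_mod_group N"
    and "H = multiples N p1 (n1 * n2 * n3 * p2)"
    and "coset_representatives G H K"
    and "K = K1 \<union> K2" and "K1 \<inter> K2 = {}"
    and "A = multiples N (n1 * p1 * n3) n2"
    and "B = multiples N (n2 * p2 * p1) n1"
    and "U = multiples N (n1 * n2 * n3 * p1) p2"
    and "V = multiples N (n1 * p1 * n2 * p2) n3"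
    and "U' = multiples N (n2 * p1) p2"
    and "V' = multiples N (n1 * p1) n3"
    and "S = A <#>\<^bsub>G\<^esub> B"
    and "R = (U <#>\<^bsub>G\<^esub> V' <#>\<^bsub>G\<^esub> K1) \<union> (U' <#>\<^bsub>G\<^esub> V <#>\<^bsub>G\<^esub> K2)"
    and "\<not> periodic G R"
  shows "vuza_canon G S R"
proof -
  note cop = \<open>coprime (n1 * n3) (n2 * p2)\<close>
  have cop': "coprime (n2 * p2) (n1 * n3)"
    using cop by (rule coprime_commute[THEN iffD1])
  have p2: "p2 > 0" "p2 \<noteq> 1"
    using \<open>prime p2\<close> by (auto simp: prime_gt_0_nat)
  have pos: "n1 > 0" "n3 > 0" "n2 > 0" "p2 > 0"
    using assms(4-6) p2 by auto
  define m where "m = n1 * n3 * n2 * p2"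
  have N: "N = p1 * m" "N > 0"
    using assms(1,4-6,10) p2 by (auto simp: m_def prime_gt_0_nat)
  have H: "H = multiples N p1 m"
    using assms(12) by (simp add: m_def ac_simps)
  \<comment> \<open>The elements of \<open>S\<close>, and those of \<open>R\<close> in the coset of \<open>k\<close> minus \<open>k\<close>, divided by \<open>p1\<close>.\<close>
  define s :: "nat \<times> nat \<Rightarrow> int" where
    "s = (\<lambda>(i, j). int (n1*n3*i + n2*p2*j))"
  define r :: "int \<Rightarrow> nat \<times> nat \<Rightarrow> int" where
    "r = (\<lambda>k (x, y). if k \<in> K1 then int (n1*n3*n2*x + n1*y) else int (n2*p2*n1*y + n2*x))"
  have S: "g \<in> S \<longleftrightarrow> g \<in> {0..<int N} \<and>
      (\<exists>i<n2. \<exists>j<n1. [g = int p1 * int (n1*n3*i + n2*p2*j)] (mod int N))" for g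
    unfolding assms(11,16,17,22) multiples_set_mult[OF N(2)] by (simp add: algebra_simps)
  have R: "g \<in> R \<longleftrightarrow> g \<in> {0..<int N} \<and>
      (\<exists>k\<in>K. \<exists>q\<in>{..<p2}\<times>{..<n3}. [g = k + int p1 * r k q] (mod int N))" for g
  proof -
    have pairs: "(\<exists>q\<in>{..<p2}\<times>{..<n3}. Q q) \<longleftrightarrow> (\<exists>x<p2. \<exists>y<n3. Q (x, y))" for Q
      by auto
    have r1: "k + int p1 * r k (x, y) = int (x * (n1*n2*n3*p1) + y * (n1*p1)) + k"
      if "k \<in> K1" for k x y
      using that by (simp add: r_def algebra_simps)
    have "(\<exists>k\<in>K1. \<exists>x<p2. \<exists>y<n3. [g = k + int p1 * r k (x, y)] (mod int N)) \<longleftrightarrow>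
      (\<exists>k\<in>K1. \<exists>x<p2. \<exists>y<n3. [g = int (x * (n1*n2*n3*p1) + y * (n1*p1)) + k] (mod int N))"
      by (rule bex_cong[OF refl]) (simp only: r1)
    then have "g \<in> U <#>\<^bsub>G\<^esub> V' <#>\<^bsub>G\<^esub> K1 \<longleftrightarrow> g \<in> {0..<int N} \<and>
      (\<exists>k\<in>K1. \<exists>q\<in>{..<p2}\<times>{..<n3}. [g = k + int p1 * r k q] (mod int N))"
      unfolding assms(11,18,21) multiples_set_mult_set[OF N(2)] pairs by blast
    moreover have r2: "k + int p1 * r k (x, y) = int (x * (n2*p1) + y * (n1*p1*n2*p2)) + k"
      if "k \<in> K2" for k x y
    proof -
      have "k \<notin> K1"
        using that assms(15) by blast
      then show ?thesis
        by (simp add: r_def algebra_simps)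
    qed
    have "(\<exists>k\<in>K2. \<exists>x<p2. \<exists>y<n3. [g = k + int p1 * r k (x, y)] (mod int N)) \<longleftrightarrow>
      (\<exists>k\<in>K2. \<exists>x<p2. \<exists>y<n3. [g = int (x * (n2*p1) + y * (n1*p1*n2*p2)) + k] (mod int N))"
      by (rule bex_cong[OF refl]) (simp only: r2)
    then have "g \<in> U' <#>\<^bsub>G\<^esub> V <#>\<^bsub>G\<^esub> K2 \<longleftrightarrow> g \<in> {0..<int N} \<and>
      (\<exists>k\<in>K2. \<exists>q\<in>{..<p2}\<times>{..<n3}. [g = k + int p1 * r k q] (mod int N))"
      unfolding assms(11,19,20) multiples_set_mult_set[OF N(2)] pairs by blast
    ultimately show ?thesis
      unfolding assms(14,23) by blast
  qed
  have sum1: "s (i, j) + r k (x, y) = int (n1*n3*i + n2*p2*j + n1*n3*n2*x + n1*y)"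
    if "k \<in> K1" for i j k x y
    using that by (simp add: s_def r_def)
  have sum2: "s (i, j) + r k (x, y) = int (n2*p2*j + n1*n3*i + n2*p2*n1*y + n2*x)"
    if "k \<notin> K1" for i j k x y
    using that by (simp add: s_def r_def)
  \<comment> \<open>The second system is the first one with \<open>(n1, n3)\<close> and \<open>(n2, p2)\<close> exchanged.\<close>
  have m_swap: "m = n2*p2*n1*n3"
    by (simp add: m_def)
  have tiling: "\<exists>!q. q \<in> ({..<n2}\<times>{..<n1}) \<times> ({..<p2}\<times>{..<n3})
      \<and> [s (fst q) + r k (snd q) = h] (mod int m)" for k h
  proof -
    have "\<exists>i<n2. \<exists>j<n1. \<exists>x<p2. \<exists>y<n3. [s (i, j) + r k (x, y) = h] (mod int m)"
    proof (cases "k \<in> K1")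
      case True
      show ?thesis
        unfolding sum1[OF True] m_def using mixed_radix_exists[OF cop pos] by metis
    next
      case False
      show ?thesis
        unfolding sum2[OF False] m_swap using mixed_radix_exists[OF cop' pos(3,4,1,2)] by metis
    qed
    then obtain i j x y where ijxy: "i < n2" "j < n1" "x < p2" "y < n3"
      "[s (i, j) + r k (x, y) = h] (mod int m)"
      by blast
    have unique: "((i', j'), (x', y')) = ((i, j), (x, y))"
      if less: "i' < n2" "j' < n1" "x' < p2" "y' < n3"
        and sum: "[s (i', j') + r k (x', y') = h] (mod int m)" for i' j' x' y'
    proof -
      have eq: "[s (i', j') + r k (x', y') = s (i, j) + r k (x, y)] (mod int m)"
        using sum cong_sym[OF ijxy(5)] by (rule cong_trans)
      have "i' = i \<and> j' = j \<and> x' = x \<and> y' = y"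
      proof (cases "k \<in> K1")
        case True
        from mixed_radix_unique[OF cop pos(1) less ijxy(1-4) eq[unfolded sum1[OF True] m_def]]
        show ?thesis .
      next
        case False
        from mixed_radix_unique[OF cop' pos(3) less(2,1,4,3) ijxy(2,1,4,3)
            eq[unfolded sum2[OF False] m_swap]]
        show ?thesis by blast
      qed
      then show ?thesis by blast
    qed
    show ?thesis
    proof (rule ex1I[of _ "((i, j), (x, y))"])
      show "((i, j), (x, y)) \<in> ({..<n2}\<times>{..<n1}) \<times> ({..<p2}\<times>{..<n3})
        \<and> [s (fst ((i, j), (x, y))) + r k (snd ((i, j), (x, y))) = h] (mod int m)"
        unfolding fst_conv snd_conv using ijxy by blast
    next
      fix q
      assume q: "q \<in> ({..<n2}\<times>{..<n1}) \<times> ({..<p2}\<times>{..<n3})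
        \<and> [s (fst q) + r k (snd q) = h] (mod int m)"
      obtain i' j' x' y' where q_eq: "q = ((i', j'), (x', y'))"
        by (metis surj_pair)
      show "q = ((i, j), (x, y))"
        using q unfolding q_eq fst_conv snd_conv by (intro unique) blast+
    qed
  qed
  have "factorization G S R"
    unfolding assms(11)
    by (rule factorization_coset_wise[OF N _ tiling _ R])
      (use assms(11,13) H S in \<open>auto simp: s_def\<close>)
  moreover have "\<not> periodic G S"
    unfolding assms(11)
    by (rule not_periodic_sum_of_intervals[OF cop pos nondegenerate _ _ N(2) S])
      (use p2 N in \<open>auto simp: m_def\<close>)
  ultimately show ?thesis
    using assms(24) by (simp add: vuza_canon_def)
qed

end
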